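(* Let $\lambda\in\mathbb{R}$ and $F:=L-\lambda g$. Let $q(\cdot)\in C^2([t_1-\tau,t_2];\mathbb{R}^n)$ be an isoperimetric extremal with time delay, i.e. a solution of $$\frac{d}{dt}\left\{\partial_3F[q]_\tau(t)+\partial_5F[q]_\tau(t+\tau)\right\}=\partial_2F[q]_\tau(t)+\partial_4F[q]_\tau(t+\tau),\quad t_1\le t\le t_2-\tau,$$ $$\frac{d}{dt}\partial_3F[q]_\tau(t)=\partial_2F[q]_\tau(t),\quad t_2-\tau<t\le t_2,$$ and suppose that $$\partial_4F[q]_\tau(t+\tau)\cdot\dot q(t)+\partial_5F[q]_\tau(t+\tau)\cdot\ddot q(t)=0\qquad\text{for all }t\in[t_1-\tau,t_2-\tau].$$ Then $$\frac{d}{dt}\left\{F[q]_\tau(t)-\dot q(t)\cdot\left(\partial_3F[q]_\tau(t)+\partial_5F[q]_\tau(t+\tau)\right)\right\}=\partial_1F[q]_\tau(t)$$ for $t_1\le t\le t_2-\tau$, and $$\frac{d}{dt}\left\{F[q]_\tau(t)-\dot q(t)\cdot\partial_3F[q]_\tau(t)\right\}=\partial_1F[q]_\tau(t)$$ for $t_2-\tau<t\le t_2$.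
   Context: Fixed data: real numbers $t_1<t_2$, a delay $\tau$ with $0<\tau<t_2-t_1$, $n\in\mathbb{N}$; $L,g:[t_1,t_2]\times(\mathbb{R}^n)^4\to\mathbb{R}$ are of class $C^1$ ($L$ is the Lagrangian, $g$ the integrand of an isoperimetric constraint, $F$ the augmented Lagrangian). Notation: $\dot q=dq/dt$; $[q]_\tau(t):=(t,q(t),\dot q(t),q(t-\tau),\dot q(t-\tau))$; $F[q]_\tau(t):=F([q]_\tau(t))$; $\partial_iF$ ($i=1,\dots,5$) is the partial derivative (gradient) with respect to the $i$-th argument (argument 1 is in $\mathbb{R}$, arguments 2--5 are in $\mathbb{R}^n$), and $\partial_iF[q]_\tau(t+\tau)$ means $\partial_iF$ evaluated at $[q]_\tau(t+\tau)$. The dot $\cdot$ is the Euclidean inner product. *)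

theory Defs
  imports "HOL-Analysis.Analysis"
begin

text \<open>
  Derivatives on \<open>S\<close> are taken within \<open>S\<close>, hence one-sided at boundary points. For the sets used
  below, \<open>{t1..t2} \<times> UNIV\<close> and nondegenerate compact intervals, they are unique.
\<close>

definition C1_on :: "'a::real_normed_vector set \<Rightarrow> ('a \<Rightarrow> 'b::real_normed_vector) \<Rightarrow> bool" where
  "C1_on S f \<longleftrightarrow>
     (\<exists>f' :: 'a \<Rightarrow> 'a \<Rightarrow>\<^sub>L 'b.
        (\<forall>x\<in>S. (f has_derivative blinfun_apply (f' x)) (at x within S)) \<and> continuous_on S f')"

definition tderiv :: "real set \<Rightarrow> (real \<Rightarrow> 'a::real_normed_vector) \<Rightarrow> real \<Rightarrow> 'a" where
  "tderiv J q t = vector_derivative q (at t within J)"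

definition C2_curve_on :: "real set \<Rightarrow> (real \<Rightarrow> 'a::real_normed_vector) \<Rightarrow> bool" where
  "C2_curve_on J q \<longleftrightarrow> C1_on J q \<and> C1_on J (tderiv J q)"

type_synonym 'n delay_arg = "real \<times> (real^'n) \<times> (real^'n) \<times> (real^'n) \<times> (real^'n)"

definition grad :: "('a::real_inner \<Rightarrow> real) \<Rightarrow> 'a \<Rightarrow> 'a" where
  "grad f x = (THE D. GDERIV f x :> D)"

text \<open>
  The partial derivatives of \<open>F\<close>. Only the first argument ranges over a proper subset \<open>T\<close> of its
  space, so only \<open>pd1\<close> is a derivative within a set.
\<close>

definition pd1 :: "real set \<Rightarrow> ('n::finite delay_arg \<Rightarrow> real) \<Rightarrow> 'n delay_arg \<Rightarrow> real" where
  "pd1 T F = (\<lambda>(t, x, v, y, w). vector_derivative (\<lambda>s. F (s, x, v, y, w)) (at t within T))"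

definition pd2 :: "('n::finite delay_arg \<Rightarrow> real) \<Rightarrow> 'n delay_arg \<Rightarrow> real^'n" where
  "pd2 F = (\<lambda>(t, x, v, y, w). grad (\<lambda>z. F (t, z, v, y, w)) x)"

definition pd3 :: "('n::finite delay_arg \<Rightarrow> real) \<Rightarrow> 'n delay_arg \<Rightarrow> real^'n" where
  "pd3 F = (\<lambda>(t, x, v, y, w). grad (\<lambda>z. F (t, x, z, y, w)) v)"

definition pd4 :: "('n::finite delay_arg \<Rightarrow> real) \<Rightarrow> 'n delay_arg \<Rightarrow> real^'n" where
  "pd4 F = (\<lambda>(t, x, v, y, w). grad (\<lambda>z. F (t, x, v, z, w)) y)"

definition pd5 :: "('n::finite delay_arg \<Rightarrow> real) \<Rightarrow> 'n delay_arg \<Rightarrow> real^'n" where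
  "pd5 F = (\<lambda>(t, x, v, y, w). grad (\<lambda>z. F (t, x, v, y, z)) w)"

text \<open>
  \<open>delay_jet J \<tau> q t\<close> is \<open>[q]\<^sub>\<tau>(t)\<close> for a curve \<open>q\<close> defined on \<open>J\<close>; it is meaningful when \<open>t\<close> and
  \<open>t - \<tau>\<close> both lie in \<open>J\<close>.
\<close>

definition delay_jet :: "real set \<Rightarrow> real \<Rightarrow> (real \<Rightarrow> real^'n::finite) \<Rightarrow> real \<Rightarrow> 'n delay_arg" where
  "delay_jet J \<tau> q t = (t, q t, tderiv J q t, q (t - \<tau>), tderiv J q (t - \<tau>))"

text \<open>
  The Euler--Lagrange equations with delay for an integrand \<open>F\<close> on \<open>{t1..t2}\<close>. The first equation
  involves \<open>[q]\<^sub>\<tau>(t + \<tau>)\<close>, which exists only for \<open>t \<le> t2 - \<tau>\<close>; at \<open>t2 - \<tau>\<close> its time derivative is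
  therefore the left derivative. The equations include the existence of the time derivatives.
\<close>

definition delay_extremal ::
    "real \<Rightarrow> real \<Rightarrow> real \<Rightarrow> ('n::finite delay_arg \<Rightarrow> real) \<Rightarrow> (real \<Rightarrow> real^'n) \<Rightarrow> bool" where
  "delay_extremal t1 t2 \<tau> F q \<longleftrightarrow>
     (let jet = delay_jet {t1 - \<tau>..t2} \<tau> q in
       (\<forall>t\<in>{t1..t2 - \<tau>}.
          ((\<lambda>s. pd3 F (jet s) + pd5 F (jet (s + \<tau>))) has_vector_derivative
             (pd2 F (jet t) + pd4 F (jet (t + \<tau>)))) (at t within {t1..t2 - \<tau>})) \<and>
       (\<forall>t\<in>{t2 - \<tau><..t2}.
          ((\<lambda>s. pd3 F (jet s)) has_vector_derivative pd2 F (jet t))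
             (at t within {t2 - \<tau><..t2})))"

definition isoperimetric_delay_extremal ::
    "real \<Rightarrow> real \<Rightarrow> real \<Rightarrow> ('n::finite delay_arg \<Rightarrow> real) \<Rightarrow> ('n delay_arg \<Rightarrow> real) \<Rightarrow> real
      \<Rightarrow> (real \<Rightarrow> real^'n) \<Rightarrow> bool" where
  "isoperimetric_delay_extremal t1 t2 \<tau> L g lam q \<longleftrightarrow>
     C2_curve_on {t1 - \<tau>..t2} q \<and> delay_extremal t1 t2 \<tau> (\<lambda>z. L z - lam * g z) q"

end

theory Submission
  imports Defs
begin

text \<open>
  The identities are energy balances for an explicitly time-dependent \<open>F\<close>; they come from the
  chain rule. Along the curve, the total time derivative of \<open>F[q]\<^sub>\<tau>(t)\<close> is the sum of
  \<open>\<partial>\<^sub>1F + \<partial>\<^sub>2F \<bullet> q'(t) + \<partial>\<^sub>3F \<bullet> q''(t)\<close> and the delayed part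
  \<open>\<partial>\<^sub>4F \<bullet> q'(t - \<tau>) + \<partial>\<^sub>5F \<bullet> q''(t - \<tau>)\<close>, all partial derivatives taken at \<open>[q]\<^sub>\<tau>(t)\<close>
  (\<open>has_real_derivative_along_delay_jet\<close>). The additional hypothesis at time \<open>t - \<tau>\<close>, which ranges
  over \<open>[t1 - \<tau>, t2 - \<tau>]\<close>, says exactly that the delayed part vanishes.

  Subtracting the product-rule expansion of \<open>q' \<bullet> P\<close>, where \<open>P\<close> is the momentum whose derivative the
  Euler--Lagrange equation supplies, cancels the terms with \<open>\<partial>\<^sub>2F\<close> and \<open>\<partial>\<^sub>3F\<close>. For
  \<open>t \<in> (t2 - \<tau>, t2]\<close> only \<open>\<partial>\<^sub>1F\<close> is left. For \<open>t \<in> [t1, t2 - \<tau>]\<close> there also remains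
  \<open>- (\<partial>\<^sub>4F \<bullet> q'(t) + \<partial>\<^sub>5F \<bullet> q''(t))\<close> with the partial derivatives at \<open>[q]\<^sub>\<tau>(t + \<tau>)\<close>, and it
  vanishes by the same hypothesis, now at time \<open>t\<close> itself.
  On this interval the hypothesis is thus used at two different times.
\<close>

lemma grad_eqI:
  assumes "GDERIV f x :> D"
  shows "grad f x = D"
  unfolding grad_def
proof (rule the_equality)
  show "GDERIV f x :> D"
    by (rule assms)
next
  fix E assume "GDERIV f x :> E"
  then have "(\<lambda>h. h \<bullet> E) = (\<lambda>h. h \<bullet> D)"
    using assms unfolding gderiv_def by (rule has_derivative_unique)
  then show "E = D"
    by (metis vector_eq_ldot)
qed

text \<open>
  By Riesz representation a derivative into the reals is an inner product with the gradient. It is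
  stated for \<open>F\<close> restricted along a map \<open>\<phi>\<close> into \<open>S\<close> because \<open>F\<close> itself is only differentiable within
  \<open>S\<close>; taking for \<open>\<phi>\<close> the insertion of a single argument gives the partial gradients.
\<close>

lemma derivative_eq_inner_grad:
  fixes F :: "'a::real_normed_vector \<Rightarrow> real" and \<phi> :: "'b::euclidean_space \<Rightarrow> 'a"
  assumes F: "(F has_derivative F') (at (\<phi> x) within S)"
    and \<phi>: "(\<phi> has_derivative \<phi>') (at x)" and "range \<phi> \<subseteq> S"
  shows "F' (\<phi>' h) = grad (\<lambda>z. F (\<phi> z)) x \<bullet> h"
proof -
  have d: "((\<lambda>z. F (\<phi> z)) has_derivative (\<lambda>h. F' (\<phi>' h))) (at x)"
    using has_derivative_in_compose[OF \<phi>] has_derivative_subset[OF F \<open>range \<phi> \<subseteq> S\<close>] by blast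
  then have lin: "linear (\<lambda>h. F' (\<phi>' h))"
    by (rule has_derivative_linear)
  \<comment> \<open>The Riesz representative of a linear functional is its adjoint applied to \<open>1\<close>.\<close>
  define D where "D = adjoint (\<lambda>h. F' (\<phi>' h)) 1"
  have D: "F' (\<phi>' h) = h \<bullet> D" for h
    using adjoint_works[OF lin, of h 1] by (simp add: D_def)
  have "grad (\<lambda>z. F (\<phi> z)) x = D"
    using d by (intro grad_eqI) (simp add: gderiv_def D)
  then show ?thesis
    by (simp add: D inner_commute)
qed

text \<open>
  The total derivative is linear, so it splits over the five arguments. The time slot is treated
  apart: \<open>F\<close> has only a one-sided time derivative at \<open>a\<close> and \<open>b\<close>, and it is unique because the
  interval is nondegenerate.
\<close>

lemma derivative_eq_partials:
  fixes F :: "'n::finite delay_arg \<Rightarrow> real"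
  assumes "a < b" and "t \<in> {a..b}"
    and F: "(F has_derivative F') (at (t, x, v, y, w) within {a..b} \<times> UNIV)"
  shows "F' (1, hx, hv, hy, hw) =
      pd1 {a..b} F (t, x, v, y, w) + pd2 F (t, x, v, y, w) \<bullet> hx + pd3 F (t, x, v, y, w) \<bullet> hv
    + pd4 F (t, x, v, y, w) \<bullet> hy + pd5 F (t, x, v, y, w) \<bullet> hw"
proof -
  have lin: "linear F'"
    using F by (rule has_derivative_linear)
  have "((\<lambda>s. F (s, x, v, y, w)) has_derivative (\<lambda>h. F' (h, 0, 0, 0, 0))) (at t within {a..b})"
  proof (rule has_derivative_in_compose[where f = "\<lambda>s. (s, x, v, y, w)"])
    show "((\<lambda>s. (s, x, v, y, w)) has_derivative (\<lambda>h. (h, 0, 0, 0, 0))) (at t within {a..b})"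
      by (intro has_derivative_Pair has_derivative_ident has_derivative_const)
    show "(F has_derivative F') (at (t, x, v, y, w) within (\<lambda>s. (s, x, v, y, w)) ` {a..b})"
      using F by (rule has_derivative_subset) auto
  qed
  moreover have "(\<lambda>h. F' (h, 0, 0, 0, 0)) = (\<lambda>h. h *\<^sub>R F' (1, 0, 0, 0, 0))"
  proof
    show "F' (h, 0, 0, 0, 0) = h *\<^sub>R F' (1, 0, 0, 0, 0)" for h
      using linear_scale[OF lin, of h "(1, 0, 0, 0, 0)"] by (simp add: zero_prod_def[symmetric])
  qed
  ultimately have "((\<lambda>s. F (s, x, v, y, w)) has_vector_derivative F' (1, 0, 0, 0, 0))
      (at t within {a..b})"
    by (simp only: has_vector_derivative_def)
  then have 1: "F' (1, 0, 0, 0, 0) = pd1 {a..b} F (t, x, v, y, w)"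
    by (simp only: pd1_def prod.case vector_derivative_within_closed_interval[OF \<open>a < b\<close> \<open>t \<in> {a..b}\<close>])
  note slot_derivative = has_derivative_Pair has_derivative_ident has_derivative_const
  have 2: "F' (0, hx, 0, 0, 0) = pd2 F (t, x, v, y, w) \<bullet> hx"
    unfolding pd2_def prod.case
    by (rule derivative_eq_inner_grad[where \<phi> = "\<lambda>z. (t, z, v, y, w)"
          and \<phi>' = "\<lambda>h. (0, h, 0, 0, 0)", OF F])
      ((intro slot_derivative)[1], use \<open>t \<in> {a..b}\<close> in auto)
  have 3: "F' (0, 0, hv, 0, 0) = pd3 F (t, x, v, y, w) \<bullet> hv"
    unfolding pd3_def prod.case
    by (rule derivative_eq_inner_grad[where \<phi> = "\<lambda>z. (t, x, z, y, w)"
          and \<phi>' = "\<lambda>h. (0, 0, h, 0, 0)", OF F])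
      ((intro slot_derivative)[1], use \<open>t \<in> {a..b}\<close> in auto)
  have 4: "F' (0, 0, 0, hy, 0) = pd4 F (t, x, v, y, w) \<bullet> hy"
    unfolding pd4_def prod.case
    by (rule derivative_eq_inner_grad[where \<phi> = "\<lambda>z. (t, x, v, z, w)"
          and \<phi>' = "\<lambda>h. (0, 0, 0, h, 0)", OF F])
      ((intro slot_derivative)[1], use \<open>t \<in> {a..b}\<close> in auto)
  have 5: "F' (0, 0, 0, 0, hw) = pd5 F (t, x, v, y, w) \<bullet> hw"
    unfolding pd5_def prod.case
    by (rule derivative_eq_inner_grad[where \<phi> = "\<lambda>z. (t, x, v, y, z)"
          and \<phi>' = "\<lambda>h. (0, 0, 0, 0, h)", OF F])
      ((intro slot_derivative)[1], use \<open>t \<in> {a..b}\<close> in auto)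
  have "(1 :: real, hx, hv, hy, hw) = (1, 0, 0, 0, 0) + (0, hx, 0, 0, 0) + (0, 0, hv, 0, 0)
      + (0, 0, 0, hy, 0) + (0, 0, 0, 0, hw)"
    by simp
  then have "F' (1, hx, hv, hy, hw) = F' (1, 0, 0, 0, 0) + F' (0, hx, 0, 0, 0) + F' (0, 0, hv, 0, 0)
      + F' (0, 0, 0, hy, 0) + F' (0, 0, 0, 0, hw)"
    by (simp only: linear_add[OF lin])
  then show ?thesis
    by (simp only: 1 2 3 4 5)
qed

lemma C1_on_has_vector_derivative_tderiv:
  assumes "C1_on J q" and "t \<in> J"
  shows "(q has_vector_derivative tderiv J q t) (at t within J)"
proof -
  have "q differentiable (at t within J)"
    using assms unfolding C1_on_def differentiable_def by blast
  then show ?thesis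
    by (simp add: tderiv_def vector_derivative_works)
qed

lemma has_vector_derivative_delay_shift:
  assumes "(f has_vector_derivative D) (at (t - \<tau>) within {a - \<tau>..b})" and "0 \<le> \<tau>"
  shows "((\<lambda>s. f (s - \<tau>)) has_vector_derivative D) (at t within {a..b})"
proof -
  have "((\<lambda>s. s - \<tau>) has_vector_derivative 1) (at t within {a..b})"
    by (auto intro!: derivative_eq_intros)
  moreover have "(f has_vector_derivative D) (at (t - \<tau>) within (\<lambda>s. s - \<tau>) ` {a..b})"
    using assms(1) by (rule has_vector_derivative_within_subset) (use assms(2) in auto)
  ultimately show ?thesis
    using vector_diff_chain_within[of "\<lambda>s. s - \<tau>" 1 t "{a..b}" f D] by (simp add: comp_def)
qed

lemma has_real_derivative_along_delay_jet:
  fixes F :: "'n::finite delay_arg \<Rightarrow> real" and q :: "real \<Rightarrow> real^'n" and a b \<tau> :: real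
  defines "J \<equiv> {a - \<tau>..b}"
  assumes "a < b" and "0 \<le> \<tau>" and t: "t \<in> {a..b}" and q: "C2_curve_on J q"
    and F: "(F has_derivative F') (at (delay_jet J \<tau> q t) within {a..b} \<times> UNIV)"
  shows "((\<lambda>s. F (delay_jet J \<tau> q s)) has_real_derivative
      pd1 {a..b} F (delay_jet J \<tau> q t)
    + pd2 F (delay_jet J \<tau> q t) \<bullet> tderiv J q t
    + pd3 F (delay_jet J \<tau> q t) \<bullet> tderiv J (tderiv J q) t
    + pd4 F (delay_jet J \<tau> q t) \<bullet> tderiv J q (t - \<tau>)
    + pd5 F (delay_jet J \<tau> q t) \<bullet> tderiv J (tderiv J q) (t - \<tau>)) (at t within {a..b})"
proof -
  have sub: "{a..b} \<subseteq> J" and in_J: "t \<in> J" "t - \<tau> \<in> J"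
    using t \<open>0 \<le> \<tau>\<close> by (auto simp: J_def)
  have C1: "C1_on J q" "C1_on J (tderiv J q)"
    using q by (auto simp: C2_curve_on_def)
  note here = has_vector_derivative_within_subset[OF C1_on_has_vector_derivative_tderiv sub]
  have delayed: "((\<lambda>s. f (s - \<tau>)) has_vector_derivative tderiv J f (t - \<tau>)) (at t within {a..b})"
    if "C1_on J f" for f :: "real \<Rightarrow> real^'n"
    using C1_on_has_vector_derivative_tderiv[OF that in_J(2)] \<open>0 \<le> \<tau>\<close>
    unfolding J_def by (rule has_vector_derivative_delay_shift)
  let ?h = "(1, tderiv J q t, tderiv J (tderiv J q) t,
      tderiv J q (t - \<tau>), tderiv J (tderiv J q) (t - \<tau>))"
  have "(delay_jet J \<tau> q has_vector_derivative ?h) (at t within {a..b})"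
    unfolding delay_jet_def
    by (intro has_vector_derivative_Pair has_vector_derivative_id here delayed C1 in_J)
  moreover have "(F has_derivative F')
      (at (delay_jet J \<tau> q t) within delay_jet J \<tau> q ` {a..b})"
    using F by (rule has_derivative_subset) (auto simp: delay_jet_def)
  ultimately have "((\<lambda>s. F (delay_jet J \<tau> q s)) has_vector_derivative F' ?h) (at t within {a..b})"
    using vector_derivative_diff_chain_within[of "delay_jet J \<tau> q"] by (simp add: comp_def)
  moreover have "F' ?h = pd1 {a..b} F (delay_jet J \<tau> q t)
    + pd2 F (delay_jet J \<tau> q t) \<bullet> tderiv J q t
    + pd3 F (delay_jet J \<tau> q t) \<bullet> tderiv J (tderiv J q) t
    + pd4 F (delay_jet J \<tau> q t) \<bullet> tderiv J q (t - \<tau>)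
    + pd5 F (delay_jet J \<tau> q t) \<bullet> tderiv J (tderiv J q) (t - \<tau>)"
    using F unfolding delay_jet_def by (rule derivative_eq_partials[OF \<open>a < b\<close> t])
  ultimately show ?thesis
    by (simp add: has_real_derivative_iff_has_vector_derivative)
qed

lemma has_real_derivative_minus_inner:
  fixes v P :: "real \<Rightarrow> 'a::real_inner"
  assumes "(f has_real_derivative f') (at t within A)"
    and "(v has_vector_derivative v') (at t within A)"
    and "(P has_vector_derivative P') (at t within A)"
  shows "((\<lambda>s. f s - v s \<bullet> P s) has_real_derivative f' - (v t \<bullet> P' + v' \<bullet> P t)) (at t within A)"
proof -
  have "((\<lambda>s. v s \<bullet> P s) has_real_derivative v t \<bullet> P' + v' \<bullet> P t) (at t within A)"
    using bounded_bilinear.has_vector_derivative[OF bounded_bilinear_inner assms(2,3)]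
    by (simp only: has_real_derivative_iff_has_vector_derivative)
  with assms(1) show ?thesis
    by (rule DERIV_diff)
qed

theorem theorem3p6:
  fixes t1 t2 \<tau> lam :: real
    and L g F :: "'n::finite delay_arg \<Rightarrow> real"
    and q :: "real \<Rightarrow> real^'n"
  defines "F \<equiv> \<lambda>z. L z - lam * g z"
    and "J \<equiv> {t1 - \<tau>..t2}"
  assumes "t1 < t2" and "0 < \<tau>" and "\<tau> < t2 - t1"
    and "C1_on ({t1..t2} \<times> UNIV) L" and "C1_on ({t1..t2} \<times> UNIV) g"
    and "isoperimetric_delay_extremal t1 t2 \<tau> L g lam q"
    and "\<forall>t\<in>{t1 - \<tau>..t2 - \<tau>}.
           pd4 F (delay_jet J \<tau> q (t + \<tau>)) \<bullet> tderiv J q t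
         + pd5 F (delay_jet J \<tau> q (t + \<tau>)) \<bullet> tderiv J (tderiv J q) t = 0"
  shows "(\<forall>t\<in>{t1..t2 - \<tau>}.
            ((\<lambda>s. F (delay_jet J \<tau> q s)
                  - tderiv J q s \<bullet> (pd3 F (delay_jet J \<tau> q s) + pd5 F (delay_jet J \<tau> q (s + \<tau>))))
               has_real_derivative pd1 {t1..t2} F (delay_jet J \<tau> q t))
              (at t within {t1..t2 - \<tau>})) \<and>
         (\<forall>t\<in>{t2 - \<tau><..t2}.
            ((\<lambda>s. F (delay_jet J \<tau> q s) - tderiv J q s \<bullet> pd3 F (delay_jet J \<tau> q s))
               has_real_derivative pd1 {t1..t2} F (delay_jet J \<tau> q t))
              (at t within {t2 - \<tau><..t2}))"
proof (intro conjI ballI)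
  have q: "C2_curve_on J q" and ext: "delay_extremal t1 t2 \<tau> F q"
    using assms(8) by (auto simp: isoperimetric_delay_extremal_def J_def F_def)
  note delay_terms_zero = assms(9)[rule_format]
  have v: "(tderiv J q has_vector_derivative tderiv J (tderiv J q) t) (at t within A)"
    if "t \<in> A" "A \<subseteq> J" for t A
  proof (rule has_vector_derivative_within_subset[OF C1_on_has_vector_derivative_tderiv])
    show "C1_on J (tderiv J q)"
      using q by (simp add: C2_curve_on_def)
  qed (use that in auto)
  obtain L' where L': "\<And>z. z \<in> {t1..t2} \<times> UNIV \<Longrightarrow>
      (L has_derivative blinfun_apply (L' z)) (at z within {t1..t2} \<times> UNIV)"
    using assms(6) unfolding C1_on_def by blast
  obtain g' where g': "\<And>z. z \<in> {t1..t2} \<times> UNIV \<Longrightarrow>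
      (g has_derivative blinfun_apply (g' z)) (at z within {t1..t2} \<times> UNIV)"
    using assms(7) unfolding C1_on_def by blast
  have dF: "((\<lambda>s. F (delay_jet J \<tau> q s)) has_real_derivative
      pd1 {t1..t2} F (delay_jet J \<tau> q t)
    + pd2 F (delay_jet J \<tau> q t) \<bullet> tderiv J q t
    + pd3 F (delay_jet J \<tau> q t) \<bullet> tderiv J (tderiv J q) t) (at t within A)"
    if A: "A \<subseteq> {t1..t2}" "t \<in> A" for t A
  proof -
    have "delay_jet J \<tau> q t \<in> {t1..t2} \<times> UNIV"
      using A by (auto simp: delay_jet_def)
    then have "(F has_derivative (\<lambda>h. blinfun_apply (L' (delay_jet J \<tau> q t)) h
        - lam * blinfun_apply (g' (delay_jet J \<tau> q t)) h))
        (at (delay_jet J \<tau> q t) within {t1..t2} \<times> UNIV)"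
      unfolding F_def by (intro has_derivative_diff has_derivative_mult_right L' g')
    then have d: "((\<lambda>s. F (delay_jet J \<tau> q s)) has_real_derivative
        pd1 {t1..t2} F (delay_jet J \<tau> q t)
      + pd2 F (delay_jet J \<tau> q t) \<bullet> tderiv J q t
      + pd3 F (delay_jet J \<tau> q t) \<bullet> tderiv J (tderiv J q) t
      + pd4 F (delay_jet J \<tau> q t) \<bullet> tderiv J q (t - \<tau>)
      + pd5 F (delay_jet J \<tau> q t) \<bullet> tderiv J (tderiv J q) (t - \<tau>)) (at t within {t1..t2})"
      using A \<open>t1 < t2\<close> \<open>0 < \<tau>\<close> q unfolding J_def
      by (intro has_real_derivative_along_delay_jet) auto
    \<comment> \<open>The jet at \<open>t\<close> is the advanced jet of time \<open>t - \<tau>\<close>, where the hypothesis applies.\<close>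
    have "pd4 F (delay_jet J \<tau> q t) \<bullet> tderiv J q (t - \<tau>)
      + pd5 F (delay_jet J \<tau> q t) \<bullet> tderiv J (tderiv J q) (t - \<tau>) = 0"
      using delay_terms_zero[of "t - \<tau>"] A by auto
    with DERIV_subset[OF d A(1)] show ?thesis
      by (simp add: add.assoc)
  qed
  {
    fix t assume t: "t \<in> {t1..t2 - \<tau>}"
    have sub: "{t1..t2 - \<tau>} \<subseteq> {t1..t2}" "{t1..t2 - \<tau>} \<subseteq> J"
      using \<open>0 < \<tau>\<close> by (auto simp: J_def)
    have P: "((\<lambda>s. pd3 F (delay_jet J \<tau> q s) + pd5 F (delay_jet J \<tau> q (s + \<tau>)))
        has_vector_derivative pd2 F (delay_jet J \<tau> q t) + pd4 F (delay_jet J \<tau> q (t + \<tau>)))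
        (at t within {t1..t2 - \<tau>})"
      using ext t by (simp add: delay_extremal_def Let_def J_def)
    have "pd4 F (delay_jet J \<tau> q (t + \<tau>)) \<bullet> tderiv J q t
      + pd5 F (delay_jet J \<tau> q (t + \<tau>)) \<bullet> tderiv J (tderiv J q) t = 0"
      using t \<open>0 < \<tau>\<close> by (intro delay_terms_zero) auto
    with has_real_derivative_minus_inner[OF dF[OF sub(1) t] v[OF t sub(2)] P]
    show "((\<lambda>s. F (delay_jet J \<tau> q s)
          - tderiv J q s \<bullet> (pd3 F (delay_jet J \<tau> q s) + pd5 F (delay_jet J \<tau> q (s + \<tau>))))
        has_real_derivative pd1 {t1..t2} F (delay_jet J \<tau> q t)) (at t within {t1..t2 - \<tau>})"
      by (elim DERIV_cong) (simp add: inner_add_right inner_commute)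
  next
    fix t assume t: "t \<in> {t2 - \<tau><..t2}"
    have sub: "{t2 - \<tau><..t2} \<subseteq> {t1..t2}" "{t2 - \<tau><..t2} \<subseteq> J"
      using \<open>0 < \<tau>\<close> \<open>\<tau> < t2 - t1\<close> by (auto simp: J_def)
    have P: "((\<lambda>s. pd3 F (delay_jet J \<tau> q s)) has_vector_derivative pd2 F (delay_jet J \<tau> q t))
        (at t within {t2 - \<tau><..t2})"
      using ext t by (simp add: delay_extremal_def Let_def J_def)
    show "((\<lambda>s. F (delay_jet J \<tau> q s) - tderiv J q s \<bullet> pd3 F (delay_jet J \<tau> q s))
        has_real_derivative pd1 {t1..t2} F (delay_jet J \<tau> q t)) (at t within {t2 - \<tau><..t2})"
      using has_real_derivative_minus_inner[OF dF[OF sub(1) t] v[OF t sub(2)] P]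
      by (elim DERIV_cong) (simp add: inner_commute)
  }
qed

end
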